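(* Let $X\sim\pi$, where $\pi$ is the stationary distribution of the Elo process. Denote $\eta=1+2\max_i|\rho^i|$. Then, for all $K\le\ell_\eta/2$, we have $$\mathbb{E}\left[\frac1N|X-\rho|_1\right]\le\frac{N-1}{N}\sqrt{\frac{8K}{\ell_\eta}}.$$
   Context: Notation: $\mathbb{N}=\{0,1,2,\dots\}$; $N\ge 2$ is an integer (number of players); $|\cdot|_1$ is the 1-norm on $\mathbb{R}^N$; $x^i$ is the $i$-th coordinate of $x$; $e_i$ is the $i$-th canonical vector; $\mathcal{Z}_N=\{x\in\mathbb{R}^N:\sum_{i=1}^N x^i=0\}$. Standing assumptions. (i) $\rho=(\rho^1,\dots,\rho^N)\in\mathcal{Z}_N$ is a fixed vector (true skills). (ii) $b:\mathbb{R}\to(-1,1)$ is odd, strictly increasing and $L$-Lipschitz, and for every $M>0$, $\ell_M:=\inf_{-M\le v<u\le M}\frac{b(u)-b(v)}{u-v}>0$. (iii) For every distinct $i,j\in\{1,\dots,N\}$, $S^{ij}$ is a random variable with values in $[-1,1]$, $\mathbb{E}[S^{ij}]=b(\rho^i-\rho^j)$ and $S^{ji}=-S^{ij}$. (iv) $K>0$ is a constant with $KL<1$. (v) For every distinct $i,j$ and every $\epsilon>0$, $\mathbb{P}(S^{ij}<-1+\epsilon)>0$ and $\mathbb{P}(S^{ij}>1-\epsilon)>0$. Elo process: the Markov chain $(X_t)_{t\in\mathbb{N}}$ on $\mathcal{Z}_N$ started from a random vector $X_0\in\mathcal{Z}_N$ with the following dynamics: at step $t$, an ordered pair $(I_t,J_t)$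 of distinct indices in $\{1,\dots,N\}$ is chosen uniformly at random (independently of the past); given $I_t=i,J_t=j$, an independent copy $S_t^{ij}$ of $S^{ij}$ is sampled; and $X_{t+1}=X_t+K\{S_t^{ij}-b(X_t^i-X_t^j)\}(e_i-e_j)$. It has a unique stationary distribution on $\mathcal{Z}_N$, denoted $\pi$. *)

theory Defs
  imports "HOL-Probability.Probability"
begin

text \<open>
  Players are the elements of a finite type \<open>'n\<close>; \<open>x $ i\<close> is the rating of player \<open>i\<close>, and
  \<open>axis i 1\<close> is the \<open>i\<close>-th canonical vector.
\<close>

definition zero_sum :: "(real ^ 'n::finite) set" where
  "zero_sum = {x. (\<Sum>i\<in>UNIV. x $ i) = 0}"

definition norm1 :: "real ^ 'n::finite \<Rightarrow> real" where
  "norm1 x = (\<Sum>i\<in>UNIV. \<bar>x $ i\<bar>)"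

definition slope_inf :: "(real \<Rightarrow> real) \<Rightarrow> real \<Rightarrow> real" where
  "slope_inf b m = Inf {(b u - b v) / (u - v) | u v. - m \<le> v \<and> v < u \<and> u \<le> m}"

locale elo_model = prob_space M
  for M :: "'w measure" +
  fixes S :: "'n::finite \<Rightarrow> 'n \<Rightarrow> 'w \<Rightarrow> real"
    and \<rho> :: "real ^ 'n" and b :: "real \<Rightarrow> real" and L K :: real
  assumes two_players: "CARD('n) \<ge> 2"
    and skills: "\<rho> \<in> zero_sum"
    and b_range: "\<And>x. b x \<in> {-1<..<1}"
    and b_odd: "\<And>x. b (- x) = - b x"
    and b_strict_mono: "strict_mono b"
    and b_lipschitz: "L-lipschitz_on UNIV b"
    and slope_pos: "\<And>m. m > 0 \<Longrightarrow> slope_inf b m > 0"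
    and score_measurable: "\<And>i j. i \<noteq> j \<Longrightarrow> random_variable borel (S i j)"
    and score_range: "\<And>i j \<omega>. i \<noteq> j \<Longrightarrow> \<omega> \<in> space M \<Longrightarrow> S i j \<omega> \<in> {-1..1}"
    and score_expectation: "\<And>i j. i \<noteq> j \<Longrightarrow> expectation (S i j) = b (\<rho> $ i - \<rho> $ j)"
    and score_antisym: "\<And>i j \<omega>. i \<noteq> j \<Longrightarrow> \<omega> \<in> space M \<Longrightarrow> S j i \<omega> = - S i j \<omega>"
    and K_pos: "K > 0"
    and KL: "K * L < 1"
    and score_low: "\<And>i j \<epsilon>. i \<noteq> j \<Longrightarrow> \<epsilon> > 0 \<Longrightarrow> prob {\<omega> \<in> space M. S i j \<omega> < - 1 + \<epsilon>} > 0"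
    and score_high: "\<And>i j \<epsilon>. i \<noteq> j \<Longrightarrow> \<epsilon> > 0 \<Longrightarrow> prob {\<omega> \<in> space M. S i j \<omega> > 1 - \<epsilon>} > 0"

text \<open>
  The Elo process is the time-homogeneous Markov chain whose one-step transition kernel is the
  following: from rating \<open>x\<close>, draw an ordered pair of distinct players uniformly, draw the score
  of their match with the law of \<open>S i j\<close>, and update. The fresh randomness at each step
  (independent of the past) is what makes the step a function of the current rating only, so only
  the marginal laws of the \<open>S i j\<close> enter.
\<close>

definition elo_kernel ::
  "'w measure \<Rightarrow> ('n::finite \<Rightarrow> 'n \<Rightarrow> 'w \<Rightarrow> real) \<Rightarrow> (real \<Rightarrow> real) \<Rightarrow> real
    \<Rightarrow> real ^ 'n \<Rightarrow> (real ^ 'n) measure" where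
  "elo_kernel M S b K x =
     uniform_count_measure {(i, j). i \<noteq> j} \<bind> (\<lambda>(i, j).
       distr M borel (\<lambda>\<omega>. x + (K * (S i j \<omega> - b (x $ i - x $ j))) *\<^sub>R (axis i 1 - axis j 1)))"

text \<open>
  Probability measures on the space of zero-sum vectors are represented as Borel probability
  measures on the whole space that give it full mass.
\<close>

definition elo_stationary ::
  "'w measure \<Rightarrow> ('n::finite \<Rightarrow> 'n \<Rightarrow> 'w \<Rightarrow> real) \<Rightarrow> (real \<Rightarrow> real) \<Rightarrow> real
    \<Rightarrow> (real ^ 'n) measure \<Rightarrow> bool" where
  "elo_stationary M S b K \<pi> \<longleftrightarrow>
     prob_space \<pi> \<and> sets \<pi> = sets borel \<and> emeasure \<pi> zero_sum = 1 \<and>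
     (\<forall>A\<in>sets borel. (\<integral>\<^sup>+ x. emeasure (elo_kernel M S b K x) A \<partial>\<pi>) = emeasure \<pi> A)"

end

theory Submission
  imports Defs
begin

text \<open>
  The squared distance \<open>V x = |x - \<rho>|\<^sub>2\<^sup>2\<close> is a Lyapunov function. A match between \<open>i\<close> and \<open>j\<close>
  moves the rating along \<open>e\<^sub>i - e\<^sub>j\<close> by \<open>K (S - b D)\<close>, where \<open>D = x\<^sub>i - x\<^sub>j\<close>. With
  \<open>r = \<rho>\<^sub>i - \<rho>\<^sub>j\<close>, \<open>w = |D - r|\<close> and \<open>\<beta> = |b D - b r|\<close>, the monotonicity of \<open>b\<close> gives
  \<open>E V(x') - V x = 2 K (K E (S - b D)\<^sup>2 - \<beta> w)\<close>, and \<open>E (S - b D)\<^sup>2 \<le> 1 + \<beta>\<^sup>2\<close> since \<open>|S| \<le> 1\<close>.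

  Let \<open>l\<close> be the minimal slope of \<open>b\<close> on \<open>[-\<eta>, \<eta>]\<close>. This interval contains every \<open>D\<close> at
  distance at most \<open>1\<close> from \<open>r\<close>, so \<open>\<beta> \<ge> l min w 1\<close>. The restoring force is thus quadratic in \<open>w\<close>
  near the truth but only linear far away, and what it controls is the capped square
  \<open>\<phi> w = min (w\<^sup>2) w\<close>. Together with \<open>\<beta> \<le> 2\<close>, \<open>K \<beta> \<le> K L w \<le> w\<close> and
  \<open>2 K \<le> l \<le> 1\<close> the drift caused by each match is at most \<open>2 K (3 K - l \<phi> w)\<close>
  (lemmas \<open>capped_square_le_drift\<close> and \<open>match_drift\<close>). Under a stationary law the
  average drift is not negative, so the mean of \<open>\<phi>\<close> over all pairs has expectation at most
  \<open>3 K / l\<close>. As it is not known beforehand that \<open>V\<close> has finite expectation, this needs a truncation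
  argument, \<open>nn_integral_le_of_drift\<close>.

  To pass from \<open>\<phi>\<close> to \<open>w\<close>, put \<open>s = sqrt (8 K / l)\<close>, so \<open>3 K / l = 3 s\<^sup>2 / 8\<close> and \<open>s \<le> 2\<close>.
  With \<open>t = min s 1\<close> one has \<open>w \<le> \<phi> w / t + t / 4\<close> for every \<open>w \<ge> 0\<close>, hence the mean of \<open>w\<close> over all
  pairs has expectation at most \<open>3 s\<^sup>2 / (8 t) + t / 4 \<le> s\<close>. Finally, both \<open>x\<close> and \<open>\<rho>\<close> have zero
  sum, so each \<open>x\<^sub>i - \<rho>\<^sub>i\<close> is the average over \<open>j\<close> of the differences
  \<open>(x\<^sub>i - \<rho>\<^sub>i) - (x\<^sub>j - \<rho>\<^sub>j)\<close>; this gives the bound on the 1-norm with the factor \<open>(N - 1) / N\<close>,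
  as the term \<open>j = i\<close> vanishes.
\<close>

section \<open>The capped square\<close>

text \<open>
  The capped square is not convex, so Jensen's inequality does not bound a mean by it. Instead the
  identity is bounded by an affine function of the capped square. On the quadratic branch this is
  the inequality of arithmetic and geometric means, tight at \<open>u = min s 1 / 2\<close>; the linear branch
  forces the slope \<open>1 / min s 1\<close> to be at least \<open>1\<close>.
\<close>

lemma le_capped_square_linear:
  fixes s u :: real
  assumes "0 < s" "0 \<le> u"
  shows "u \<le> min (u^2) u / min s 1 + min s 1 / 4"
proof -
  define t where "t = min s 1"
  have t: "0 < t" "t \<le> 1" using assms by (auto simp: t_def)
  have "u \<le> u\<^sup>2 / t + t / 4"
  proof -
    have "0 \<le> (u - t/2)\<^sup>2" by simp
    hence "u * t \<le> u^2 + t^2/4" by (simp add: power2_eq_square algebra_simps)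
    thus ?thesis using t by (simp add: field_simps power2_eq_square)
  qed
  moreover have "u \<le> u / t + t / 4"
  proof -
    have "u * t \<le> u * 1" using t assms by (intro mult_left_mono) auto
    hence "u \<le> u / t" using t by (simp add: field_simps)
    thus ?thesis using t by simp
  qed
  ultimately show ?thesis unfolding t_def[symmetric] by (auto simp: min_def)
qed

text \<open>
  The affine bound above, evaluated at mean capped square \<open>3 s\<^sup>2 / 8\<close>, the value that the drift
  of the Elo process yields for \<open>s = sqrt (8 K / l)\<close>.
\<close>

lemma capped_square_optimum:
  fixes s :: real
  assumes "0 < s" "s \<le> 2"
  shows "(3 / 8 * s^2) / min s 1 + min s 1 / 4 \<le> s"
proof (cases "s \<le> 1")
  case True
  then show ?thesis using assms by (simp add: power2_eq_square)
next
  case False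
  have "0 \<le> (s - 1) * (2 - s)" using False assms by simp
  then have "s\<^sup>2 \<le> 3 * s - 2" by (simp add: algebra_simps power2_eq_square)
  then show ?thesis using False assms by simp
qed

text \<open>
  Here \<open>\<beta> w\<close> is the restoring force of a match and \<open>K \<beta>\<^sup>2\<close> the part of its noise that depends on
  the current ratings. The difference \<open>\<beta> (w - K \<beta>)\<close> is nonnegative, but it vanishes at
  \<open>\<beta> = w / K\<close>; the term \<open>2 K\<close> covers what it then lacks for the lower bound.
\<close>

lemma capped_square_le_drift:
  fixes \<beta> w K l :: real
  assumes "0 < K" "K \<le> l / 2" "0 < l" "l \<le> 1" "0 \<le> w"
    and lower: "l * min w 1 \<le> \<beta>" and "\<beta> \<le> 2" and lip: "K * \<beta> \<le> w"
  shows "l * min (w\<^sup>2) w \<le> \<beta> * w - K * \<beta>\<^sup>2 + 2 * K"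
proof -
  have b0: "0 \<le> \<beta>" using assms by (smt (verit) mult_nonneg_nonneg)
  have K: "2 * K \<le> 1" using assms by linarith
  \<comment> \<open>Both branches in one product, to be compared with the lower bound on \<open>\<beta>\<close>.\<close>
  have phi: "min (w\<^sup>2) w = min w 1 * w"
    using assms(5) by (simp add: min_mult_distrib_right power2_eq_square)
  consider "w \<le> 2 * K" | "w > 2 * K" "\<beta> \<le> 1" | "w > 2 * K" "\<beta> > 1" by linarith
  then show ?thesis
  proof cases
    \<comment> \<open>Ratings nearly correct: \<open>K \<beta> \<le> w\<close> makes the net force nonnegative, and \<open>2 K\<close> alone suffices.\<close>
    case 1
    have "l * min (w\<^sup>2) w \<le> 1 * w" using assms by (intro mult_mono) auto
    moreover have "0 \<le> \<beta> * (w - K * \<beta>)" using b0 lip by simp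
    ultimately show ?thesis using 1 by (simp add: algebra_simps power2_eq_square)
  next
    \<comment> \<open>Small \<open>\<beta>\<close>: the noise is at most \<open>K\<close>, and the force dominates \<open>l\<close> times the capped square.\<close>
    case 2
    have "(l * min w 1) * w \<le> \<beta> * w" using lower assms by (intro mult_right_mono) auto
    moreover have "K * \<beta>\<^sup>2 \<le> K * 1" using 2 b0 assms by (intro mult_left_mono) (auto simp: power_le_one)
    ultimately show ?thesis using assms(1) unfolding phi mult.assoc by linarith
  next
    \<comment> \<open>Large \<open>\<beta>\<close>: as \<open>\<beta> \<le> 2\<close>, the net force is at least \<open>\<beta> (w - 2 K)\<close>, and \<open>\<beta>\<close> can be lowered to \<open>1\<close>.\<close>
    case 3
    have "l * min (w\<^sup>2) w \<le> 1 * w" using assms by (intro mult_mono) auto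
    moreover have "1 * (w - 2 * K) \<le> \<beta> * (w - 2 * K)" using 3 by (intro mult_right_mono) auto
    moreover have "\<beta> * (w - 2 * K) \<le> \<beta> * (w - K * \<beta>)"
      using assms b0 by (intro mult_left_mono) auto
    ultimately show ?thesis by (simp add: algebra_simps power2_eq_square)
  qed
qed

section \<open>Moment bounds from a drift condition\<close>

text \<open>
  If \<open>V\<close> were integrable, integrating the drift condition and cancelling the integral of \<open>V\<close> on both
  sides would do. In general, the bounded function \<open>min V n\<close> satisfies the drift condition with \<open>f\<close>
  cut off to \<open>{V < n}\<close>: on this set \<open>min V n\<close> has the value \<open>V\<close> and can only become smaller than \<open>V\<close>
  after the step, and off this set it already has its maximal value \<open>n\<close>. Its integral is finite and
  cancels; then \<open>n\<close> tends to infinity.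
\<close>

lemma nn_integral_le_of_drift:
  assumes \<kappa>: "\<kappa> \<in> N \<rightarrow>\<^sub>M subprob_algebra N" and stat: "N \<bind> \<kappa> = N"
    and "prob_space N"
    and V[measurable]: "V \<in> borel_measurable N" and f[measurable]: "f \<in> borel_measurable N"
    and fin: "\<And>x. x \<in> space N \<Longrightarrow> V x < (\<infinity>::ennreal)"
    and drift: "\<And>x. x \<in> space N \<Longrightarrow> (\<integral>\<^sup>+ y. V y \<partial>\<kappa> x) + f x \<le> V x + c"
  shows "(\<integral>\<^sup>+ x. f x \<partial>N) \<le> c"
proof -
  interpret prob_space N by fact
  define A where "A n = {x \<in> space N. V x < of_nat n}" for n :: nat
  have [measurable]: "A n \<in> sets N" for n unfolding A_def by measurable
  have bound: "(\<integral>\<^sup>+ x. f x * indicator (A n) x \<partial>N) \<le> c" for n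
  proof -
    define h where "h x = min (V x) (of_nat n)" for x
    have h[measurable]: "h \<in> borel_measurable N" unfolding h_def by measurable
    have inv: "(\<integral>\<^sup>+ x. h x \<partial>N) = (\<integral>\<^sup>+ x. \<integral>\<^sup>+ y. h y \<partial>\<kappa> x \<partial>N)"
      using nn_integral_bind[OF h \<kappa>] stat by simp
    have hfin: "(\<integral>\<^sup>+ x. h x \<partial>N) \<noteq> \<infinity>"
    proof -
      have "(\<integral>\<^sup>+ x. h x \<partial>N) \<le> (\<integral>\<^sup>+ x. of_nat n \<partial>N)" by (intro nn_integral_mono) (simp add: h_def)
      also have "\<dots> < \<infinity>" by (simp add: emeasure_space_1 of_nat_less_top)
      finally show ?thesis by simp
    qed
    have step: "(\<integral>\<^sup>+ y. h y \<partial>\<kappa> x) + f x * indicator (A n) x \<le> h x + c" if x: "x \<in> space N" for x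
    proof (cases "x \<in> A n")
      case True
      have "(\<integral>\<^sup>+ y. h y \<partial>\<kappa> x) \<le> (\<integral>\<^sup>+ y. V y \<partial>\<kappa> x)" by (intro nn_integral_mono) (simp add: h_def)
      then have "(\<integral>\<^sup>+ y. h y \<partial>\<kappa> x) + f x \<le> V x + c" using drift[OF x] by (meson add_right_mono order_trans)
      then show ?thesis using True by (simp add: h_def A_def min_def less_imp_le)
    next
      case False
      have "(\<integral>\<^sup>+ y. h y \<partial>\<kappa> x) \<le> (\<integral>\<^sup>+ y. of_nat n \<partial>\<kappa> x)" by (intro nn_integral_mono) (simp add: h_def)
      also have "\<dots> = of_nat n * emeasure (\<kappa> x) (space (\<kappa> x))" by simp
      also have "\<dots> \<le> of_nat n * 1"
        using subprob_space.subprob_emeasure_le_1[OF subprob_space_kernel[OF \<kappa> x]] by (intro mult_left_mono) auto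
      finally show ?thesis using False x
        by (simp add: h_def A_def min_def not_less) (metis add_increasing2 antisym zero_le)
    qed
    have [measurable]: "(\<lambda>x. \<integral>\<^sup>+ y. h y \<partial>\<kappa> x) \<in> borel_measurable N"
      using measurable_compose[OF \<kappa> nn_integral_measurable_subprob_algebra[OF h]] .
    have "(\<integral>\<^sup>+ x. h x \<partial>N) + (\<integral>\<^sup>+ x. f x * indicator (A n) x \<partial>N)
        = (\<integral>\<^sup>+ x. (\<integral>\<^sup>+ y. h y \<partial>\<kappa> x) + f x * indicator (A n) x \<partial>N)"
      by (subst nn_integral_add) (auto simp: inv)
    also have "\<dots> \<le> (\<integral>\<^sup>+ x. h x + c \<partial>N)" using step by (intro nn_integral_mono) auto
    also have "\<dots> = (\<integral>\<^sup>+ x. h x \<partial>N) + c" by (subst nn_integral_add) (auto simp: emeasure_space_1)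
    finally show ?thesis using hfin by (simp add: ennreal_add_left_cancel_le)
  qed
  have "(\<integral>\<^sup>+ x. f x \<partial>N) = (\<integral>\<^sup>+ x. (SUP n. f x * indicator (A n) x) \<partial>N)"
  proof (intro nn_integral_cong antisym)
    fix x assume x: "x \<in> space N"
    obtain n :: nat where "V x < of_nat n" using fin[OF x] by (metis ennreal_Ex_less_of_nat infinity_ennreal_def)
    then have "f x = f x * indicator (A n) x" using x by (simp add: A_def)
    then show "f x \<le> (SUP n. f x * indicator (A n) x)" by (metis SUP_upper UNIV_I)
    show "(SUP n. f x * indicator (A n) x) \<le> f x" by (rule SUP_least) (simp add: indicator_def)
  qed
  also have "\<dots> = (SUP n. \<integral>\<^sup>+ x. f x * indicator (A n) x \<partial>N)"
  proof (rule nn_integral_monotone_convergence_SUP)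
    have "A m \<subseteq> A n" if "m \<le> n" for m n
      using that unfolding A_def by (auto intro: order_less_le_trans)
    then show "incseq (\<lambda>n x. f x * indicator (A n) x)"
      by (auto simp: incseq_def le_fun_def indicator_def)
  qed simp
  also have "\<dots> \<le> c" using bound by (rule SUP_least)
  finally show ?thesis .
qed

section \<open>Slopes of a monotone function\<close>

lemma slope_inf_le:
  assumes "mono b" "- m \<le> v" "v < u" "u \<le> m"
  shows "slope_inf b m * (u - v) \<le> b u - b v"
proof -
  have "bdd_below {(b u - b v) / (u - v) | u v. - m \<le> v \<and> v < u \<and> u \<le> m}"
    using monoD[OF assms(1)] by (intro bdd_belowI[of _ 0]) (auto intro!: divide_nonneg_pos)
  then have "slope_inf b m \<le> (b u - b v) / (u - v)"
    unfolding slope_inf_def using assms by (intro cInf_lower) auto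
  then show ?thesis using assms by (simp add: field_simps)
qed

text \<open>
  A point \<open>x\<close> at distance more than \<open>1\<close> from \<open>r\<close> may leave \<open>[-m, m]\<close>, where nothing is known of the
  slope; monotonicity still preserves the increment gained on the unit step from \<open>r\<close> towards \<open>x\<close>.
\<close>

lemma slope_inf_mult_min_le:
  assumes mono: "mono b" and l: "0 \<le> slope_inf b m" and r: "\<bar>r\<bar> \<le> m - 1"
  shows "slope_inf b m * min \<bar>x - r\<bar> 1 \<le> \<bar>b x - b r\<bar>"
proof -
  have up: "slope_inf b m * min (x - r) 1 \<le> b x - b r" if "r < x" for x
  proof -
    let ?y = "min x (r + 1)"
    have "slope_inf b m * (?y - r) \<le> b ?y - b r"
      using that r by (intro slope_inf_le mono) auto
    moreover have "b ?y \<le> b x" using monoD[OF mono] by simp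
    moreover have "?y - r = min (x - r) 1" by (auto simp: min_def)
    ultimately show ?thesis by simp
  qed
  have down: "slope_inf b m * min (r - x) 1 \<le> b r - b x" if "x < r" for x
  proof -
    let ?y = "max x (r - 1)"
    have "slope_inf b m * (r - ?y) \<le> b r - b ?y"
      using that r by (intro slope_inf_le mono) auto
    moreover have "b x \<le> b ?y" using monoD[OF mono] by simp
    moreover have "r - ?y = min (r - x) 1" by (auto simp: min_def max_def)
    ultimately show ?thesis by simp
  qed
  show ?thesis using up[of x] down[of x] by (cases x r rule: linorder_cases) auto
qed

section \<open>Pairs of players\<close>

definition distinct_pairs :: "('n::finite \<times> 'n) set" where
  "distinct_pairs = {(i, j). i \<noteq> j}"

lemma card_distinct_pairs:
  "card (distinct_pairs :: ('n::finite \<times> 'n) set) = CARD('n) * (CARD('n) - 1)"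
proof -
  have eq: "(distinct_pairs :: ('n \<times> 'n) set) = (SIGMA i:UNIV. UNIV - {i})"
    by (auto simp: distinct_pairs_def)
  show ?thesis unfolding eq by (simp add: card_Diff_singleton)
qed

definition gap :: "real ^ 'n \<Rightarrow> real ^ 'n \<Rightarrow> 'n \<times> 'n \<Rightarrow> real" where
  "gap \<rho> x p = \<bar>(x $ fst p - x $ snd p) - (\<rho> $ fst p - \<rho> $ snd p)\<bar>"

definition mean_capped_square :: "real ^ 'n \<Rightarrow> real ^ 'n::finite \<Rightarrow> real" where
  "mean_capped_square \<rho> x =
     (\<Sum>p\<in>distinct_pairs. min ((gap \<rho> x p)\<^sup>2) (gap \<rho> x p)) / real (card (distinct_pairs :: ('n \<times> 'n) set))"

text \<open>
  The zero-sum condition fixes the common additive constant, which the gaps do not see: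
  \<open>N d\<^sub>i = \<Sum>\<^sub>j (d\<^sub>i - d\<^sub>j)\<close> for \<open>d = x - \<rho>\<close>.
\<close>

lemma norm1_le_sum_gap:
  fixes x \<rho> :: "real ^ 'n::finite"
  assumes "x \<in> zero_sum" "\<rho> \<in> zero_sum"
  shows "real CARD('n) * norm1 (x - \<rho>) \<le> (\<Sum>p\<in>distinct_pairs. gap \<rho> x p)"
proof -
  let ?d = "x - \<rho>"
  have 0: "(\<Sum>j\<in>UNIV. ?d $ j) = 0" using assms by (simp add: zero_sum_def sum_subtractf)
  have "real CARD('n) * \<bar>?d $ i\<bar> \<le> (\<Sum>j\<in>UNIV - {i}. gap \<rho> x (i, j))" for i
  proof -
    have "(\<Sum>j\<in>UNIV. ?d $ i - ?d $ j) = real CARD('n) * ?d $ i" using 0 by (simp add: sum_subtractf)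
    then have "real CARD('n) * \<bar>?d $ i\<bar> = \<bar>\<Sum>j\<in>UNIV. ?d $ i - ?d $ j\<bar>" by (simp add: abs_mult)
    also have "\<dots> \<le> (\<Sum>j\<in>UNIV. gap \<rho> x (i, j))"
      by (rule order_trans[OF sum_abs]) (auto simp: gap_def algebra_simps intro!: sum_mono)
    also have "\<dots> = (\<Sum>j\<in>UNIV - {i}. gap \<rho> x (i, j))"
      by (intro sum.mono_neutral_right) (auto simp: gap_def)
    finally show ?thesis .
  qed
  then have "real CARD('n) * norm1 ?d \<le> (\<Sum>i\<in>UNIV. \<Sum>j\<in>UNIV - {i}. gap \<rho> x (i, j))"
    unfolding norm1_def sum_distrib_left by (intro sum_mono)
  also have "\<dots> = (\<Sum>p\<in>(SIGMA i:UNIV. UNIV - {i}). gap \<rho> x p)"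
    by (subst sum.Sigma) auto
  also have "(SIGMA i:UNIV. UNIV - {i}) = distinct_pairs" by (auto simp: distinct_pairs_def)
  finally show ?thesis .
qed

lemma norm1_le_mean_capped_square:
  fixes x \<rho> :: "real ^ 'n::finite"
  assumes N: "CARD('n) \<ge> 2" and x: "x \<in> zero_sum" "\<rho> \<in> zero_sum" and s: "0 < s"
  shows "1 / real CARD('n) * norm1 (x - \<rho>)
    \<le> (real CARD('n) - 1) / real CARD('n) * (mean_capped_square \<rho> x / min s 1 + min s 1 / 4)"
proof -
  let ?P = "distinct_pairs :: ('n \<times> 'n) set" and ?n = "real CARD('n)"
  have card: "real (card ?P) = ?n * (?n - 1)" using N by (simp add: card_distinct_pairs of_nat_diff)
  have pos: "?n \<ge> 2" using N by simp
  then have cpos: "real (card ?P) > 0" unfolding card by simp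
  have "?n * norm1 (x - \<rho>) \<le> (\<Sum>p\<in>?P. gap \<rho> x p)" by (rule norm1_le_sum_gap[OF x])
  also have "\<dots> \<le> (\<Sum>p\<in>?P. min ((gap \<rho> x p)\<^sup>2) (gap \<rho> x p) / min s 1 + min s 1 / 4)"
    by (intro sum_mono le_capped_square_linear[OF s]) (simp add: gap_def)
  also have "\<dots> = real (card ?P) * (mean_capped_square \<rho> x / min s 1 + min s 1 / 4)"
    using cpos by (simp add: sum.distrib sum_divide_distrib[symmetric] mean_capped_square_def distrib_left)
  finally have "?n * norm1 (x - \<rho>) \<le> ?n * ((?n - 1) * (mean_capped_square \<rho> x / min s 1 + min s 1 / 4))"
    unfolding card by (simp add: mult.assoc)
  then have "norm1 (x - \<rho>) \<le> (?n - 1) * (mean_capped_square \<rho> x / min s 1 + min s 1 / 4)"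
    using pos by (simp add: mult_le_cancel_left_pos)
  then show ?thesis using pos by (simp add: divide_right_mono)
qed

section \<open>The transition kernel of the Elo process\<close>

context elo_model
begin

definition match_update :: "'n \<Rightarrow> 'n \<Rightarrow> real ^ 'n \<Rightarrow> 'w \<Rightarrow> real ^ 'n" where
  "match_update i j x \<omega> = x + (K * (S i j \<omega> - b (x $ i - x $ j))) *\<^sub>R (axis i 1 - axis j 1)"

lemma b_mono: "mono b"
  using b_strict_mono by (rule strict_mono_mono)

lemma b_measurable [measurable]: "b \<in> borel_measurable borel"
  using lipschitz_on_continuous_on[OF b_lipschitz] by (rule borel_measurable_continuous_onI)

lemma slope_inf_le_one:
  assumes "m \<ge> 1"
  shows "slope_inf b m \<le> 1"
proof -
  have "slope_inf b m * (m - - m) \<le> b m - b (- m)" using assms by (intro slope_inf_le b_mono) auto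
  also have "\<dots> \<le> 2" using b_range[of m] b_range[of "- m"] by simp
  finally have "slope_inf b m * m \<le> 1" by simp
  moreover have "slope_inf b m * 1 \<le> slope_inf b m * m"
    using slope_pos[of m] assms by (intro mult_left_mono) auto
  ultimately show ?thesis by simp
qed

lemma distinct_pairs_nonempty: "(distinct_pairs :: ('n \<times> 'n) set) \<noteq> {}"
proof -
  have "card (distinct_pairs :: ('n \<times> 'n) set) > 0" using two_players by (simp add: card_distinct_pairs)
  then show ?thesis by auto
qed

lemma match_update_measurable:
  assumes "i \<noteq> j"
  shows "(\<lambda>(x, \<omega>). match_update i j x \<omega>) \<in> borel_measurable (borel \<Otimes>\<^sub>M M)"
proof -
  note [measurable] = score_measurable[OF assms]
  have [measurable]: "(\<lambda>x :: real ^ 'n. x $ k) \<in> borel_measurable borel" for k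
    by (intro borel_measurable_continuous_onI continuous_intros)
  show ?thesis unfolding match_update_def by measurable
qed

lemma elo_kernel_eq:
  "elo_kernel M S b K x =
     uniform_count_measure distinct_pairs \<bind> (\<lambda>p. distr M borel (match_update (fst p) (snd p) x))"
  unfolding elo_kernel_def distinct_pairs_def match_update_def by (simp add: case_prod_beta')

lemma match_law_measurable:
  assumes "p \<in> distinct_pairs"
  shows "(\<lambda>x. distr M borel (match_update (fst p) (snd p) x)) \<in> borel \<rightarrow>\<^sub>M subprob_algebra borel"
proof (rule measurable_distr2)
  show "(\<lambda>(x, \<omega>). match_update (fst p) (snd p) x \<omega>) \<in> borel_measurable (borel \<Otimes>\<^sub>M M)"
    using assms by (intro match_update_measurable) (auto simp: distinct_pairs_def)
  show "(\<lambda>_. M) \<in> borel \<rightarrow>\<^sub>M subprob_algebra M"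
    by (intro measurable_const) (simp add: space_subprob_algebra subprob_space_axioms)
qed

lemma elo_kernel_measurable: "elo_kernel M S b K \<in> borel \<rightarrow>\<^sub>M subprob_algebra borel"
proof -
  let ?P = "distinct_pairs :: ('n \<times> 'n) set"
  have "prob_space (uniform_count_measure ?P)"
    using distinct_pairs_nonempty by (intro prob_space_uniform_count_measure) auto
  then have U: "uniform_count_measure ?P \<in> space (subprob_algebra (count_space ?P))"
    by (simp add: space_subprob_algebra prob_space_imp_subprob_space
        sets_uniform_count_measure_count_space)
  show ?thesis
    unfolding elo_kernel_eq[abs_def]
  proof (rule measurable_bind'[where N = "count_space ?P"])
    show "(\<lambda>_. uniform_count_measure ?P) \<in> borel \<rightarrow>\<^sub>M subprob_algebra (count_space ?P)"
      using U by (rule measurable_const)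
    show "(\<lambda>(x, p). distr M borel (match_update (fst p) (snd p) x))
        \<in> borel \<Otimes>\<^sub>M count_space ?P \<rightarrow>\<^sub>M subprob_algebra borel"
      by (subst measurable_pair_swap_iff, rule measurable_pair_measure_countable1)
        (auto intro: match_law_measurable)
  qed
qed

lemma nn_integral_elo_kernel:
  assumes [measurable]: "h \<in> borel_measurable borel"
  shows "(\<integral>\<^sup>+ y. h y \<partial>elo_kernel M S b K x) =
    (\<Sum>p\<in>distinct_pairs. ennreal (1 / real (card (distinct_pairs :: ('n \<times> 'n) set)))
       * (\<integral>\<^sup>+ \<omega>. h (match_update (fst p) (snd p) x \<omega>) \<partial>M))"
proof -
  let ?P = "distinct_pairs :: ('n \<times> 'n) set"
  have meas: "(\<lambda>p. distr M borel (match_update (fst p) (snd p) x))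
      \<in> uniform_count_measure ?P \<rightarrow>\<^sub>M subprob_algebra borel"
    using measurable_space[OF match_law_measurable, of _ x]
    by (auto simp: measurable_def space_uniform_count_measure sets_uniform_count_measure)
  have upd: "match_update (fst p) (snd p) x \<in> borel_measurable M" if "p \<in> ?P" for p
  proof -
    have "fst p \<noteq> snd p" using that by (auto simp: distinct_pairs_def)
    from measurable_Pair2[OF match_update_measurable[OF this], of x] show ?thesis by simp
  qed
  have "(\<integral>\<^sup>+ y. h y \<partial>elo_kernel M S b K x)
      = (\<integral>\<^sup>+ p. \<integral>\<^sup>+ y. h y \<partial>distr M borel (match_update (fst p) (snd p) x) \<partial>uniform_count_measure ?P)"
    unfolding elo_kernel_eq by (rule nn_integral_bind[OF assms meas])
  also have "\<dots> = (\<Sum>p\<in>?P. ennreal (1 / real (card ?P))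
      * (\<integral>\<^sup>+ y. h y \<partial>distr M borel (match_update (fst p) (snd p) x)))"
    unfolding uniform_count_measure_def by (simp add: nn_integral_point_measure_finite)
  also have "\<dots> = (\<Sum>p\<in>?P. ennreal (1 / real (card ?P))
      * (\<integral>\<^sup>+ \<omega>. h (match_update (fst p) (snd p) x \<omega>) \<partial>M))"
    by (intro sum.cong refl) (subst nn_integral_distr, use upd in auto)
  finally show ?thesis .
qed

section \<open>Drift of the squared distance to the true skills\<close>

lemma norm_match_update:
  assumes "i \<noteq> j"
  shows "(norm (match_update i j x \<omega> - \<rho>))\<^sup>2 = (norm (x - \<rho>))\<^sup>2
    + 2 * K * (S i j \<omega> - b (x $ i - x $ j)) * ((x $ i - x $ j) - (\<rho> $ i - \<rho> $ j))
    + 2 * K\<^sup>2 * (S i j \<omega> - b (x $ i - x $ j))\<^sup>2"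
proof -
  define t where "t = K * (S i j \<omega> - b (x $ i - x $ j))"
  define e :: "real ^ 'n" where "e = axis i 1 - axis j 1"
  have e: "(x - \<rho>) \<bullet> e = (x $ i - x $ j) - (\<rho> $ i - \<rho> $ j)" "e \<bullet> e = 2"
    using assms
    by (simp_all add: e_def inner_diff_right inner_axis) (simp add: axis_def)
  have upd: "match_update i j x \<omega> - \<rho> = (x - \<rho>) + t *\<^sub>R e"
    by (simp add: match_update_def t_def e_def)
  have "(norm (match_update i j x \<omega> - \<rho>))\<^sup>2 = (norm (x - \<rho>))\<^sup>2 + 2 * t * ((x - \<rho>) \<bullet> e) + t\<^sup>2 * (e \<bullet> e)"
    unfolding upd power2_norm_eq_inner
    by (simp add: inner_add_left inner_add_right inner_commute power2_eq_square)
  then show ?thesis unfolding e by (simp add: t_def power_mult_distrib mult_ac)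
qed

lemma integrable_score:
  assumes "i \<noteq> j"
  shows "integrable M (S i j)" "integrable M (\<lambda>\<omega>. (S i j \<omega>)\<^sup>2)"
proof -
  note [measurable] = score_measurable[OF assms]
  have bound: "\<bar>S i j \<omega>\<bar> \<le> 1" if "\<omega> \<in> space M" for \<omega> using score_range[OF assms that] by auto
  show "integrable M (S i j)"
    using bound by (intro integrable_const_bound[of _ 1]) (auto intro!: AE_I2)
  show "integrable M (\<lambda>\<omega>. (S i j \<omega>)\<^sup>2)"
    using bound by (intro integrable_const_bound[of _ 1]) (auto intro!: AE_I2 simp: abs_square_le_1)
qed

text \<open>
  Bias-variance decomposition: the score has variance at most \<open>1\<close> and mean \<open>b (\<rho>\<^sub>i - \<rho>\<^sub>j)\<close>.
\<close>

lemma score_second_moment: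
  assumes "i \<noteq> j"
  shows "expectation (\<lambda>\<omega>. (S i j \<omega> - a)\<^sup>2) \<le> 1 + (b (\<rho> $ i - \<rho> $ j) - a)\<^sup>2"
proof -
  note int = integrable_score[OF assms]
  let ?r = "b (\<rho> $ i - \<rho> $ j)"
  have "expectation (\<lambda>\<omega>. (S i j \<omega>)\<^sup>2) \<le> expectation (\<lambda>\<omega>. 1)"
    using score_range[OF assms] int by (intro integral_mono) (auto simp: abs_square_le_1 abs_le_iff)
  then have "expectation (\<lambda>\<omega>. (S i j \<omega>)\<^sup>2) \<le> 1" by (simp add: prob_space)
  moreover have "expectation (\<lambda>\<omega>. (S i j \<omega> - a)\<^sup>2) = expectation (\<lambda>\<omega>. (S i j \<omega>)\<^sup>2) - 2 * a * ?r + a\<^sup>2"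
  proof -
    have "expectation (\<lambda>\<omega>. (S i j \<omega> - a)\<^sup>2) = expectation (\<lambda>\<omega>. (S i j \<omega>)\<^sup>2 + a\<^sup>2 - 2 * a * S i j \<omega>)"
      by (simp add: power2_diff mult_ac)
    then show ?thesis using int by (simp add: prob_space score_expectation[OF assms])
  qed
  moreover have "(?r - a)\<^sup>2 = ?r\<^sup>2 - 2 * a * ?r + a\<^sup>2" by (simp add: power2_diff)
  moreover have "0 \<le> ?r\<^sup>2" by simp
  ultimately show ?thesis by linarith
qed

text \<open>
  The bound is an inequality between extended nonnegative reals, so the decrease of the squared
  distance appears as a summand on the left.
\<close>

lemma match_drift:
  fixes x :: "real ^ 'n"
  assumes ij: "i \<noteq> j" and m: "m \<ge> 1" "\<bar>\<rho> $ i - \<rho> $ j\<bar> \<le> m - 1" and K: "K \<le> slope_inf b m / 2"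
  defines "w \<equiv> gap \<rho> x (i, j)"
  shows "(\<integral>\<^sup>+ \<omega>. ennreal ((norm (match_update i j x \<omega> - \<rho>))\<^sup>2) \<partial>M)
      + ennreal (2 * K * slope_inf b m * min (w\<^sup>2) w)
    \<le> ennreal ((norm (x - \<rho>))\<^sup>2 + 6 * K\<^sup>2)"
proof -
  define D r \<beta> V where "D = x $ i - x $ j" and "r = \<rho> $ i - \<rho> $ j"
    and "\<beta> = \<bar>b D - b r\<bar>" and "V = (norm (x - \<rho>))\<^sup>2"
  define E where "E = expectation (\<lambda>\<omega>. (norm (match_update i j x \<omega> - \<rho>))\<^sup>2)"
  let ?l = "slope_inf b m"
  have w: "w = \<bar>D - r\<bar>" by (simp add: w_def gap_def D_def r_def)
  have l: "0 < ?l" "?l \<le> 1" using slope_pos slope_inf_le_one m by auto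
  note int = integrable_score[OF ij]
  have intS: "integrable M (\<lambda>\<omega>. S i j \<omega> - b D)" using int by simp
  have int2: "integrable M (\<lambda>\<omega>. (S i j \<omega> - b D)\<^sup>2)"
    using int by (simp add: power2_diff mult.commute mult.left_commute)
  have eq: "(norm (match_update i j x \<omega> - \<rho>))\<^sup>2
      = V + (2 * K * (D - r)) * (S i j \<omega> - b D) + 2 * K\<^sup>2 * (S i j \<omega> - b D)\<^sup>2" for \<omega>
    unfolding norm_match_update[OF ij] V_def D_def r_def by (simp add: mult.commute mult.left_commute)
  have int_norm: "integrable M (\<lambda>\<omega>. (norm (match_update i j x \<omega> - \<rho>))\<^sup>2)"
    unfolding eq using intS int2 by simp
  have "E = V + 2 * K * ((D - r) * (b r - b D)) + 2 * K\<^sup>2 * expectation (\<lambda>\<omega>. (S i j \<omega> - b D)\<^sup>2)"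
    unfolding E_def eq using intS int2 int score_expectation[OF ij] by (simp add: prob_space r_def)
  also have "(D - r) * (b r - b D) = - (\<beta> * w)"
    unfolding w \<beta>_def using monoD[OF b_mono, of D r] monoD[OF b_mono, of r D]
    by (cases "D \<le> r") (auto simp: abs_if algebra_simps)
  also have "V + 2 * K * - (\<beta> * w) + 2 * K\<^sup>2 * expectation (\<lambda>\<omega>. (S i j \<omega> - b D)\<^sup>2)
      \<le> V + 2 * K * - (\<beta> * w) + 2 * K\<^sup>2 * (1 + \<beta>\<^sup>2)"
    using score_second_moment[OF ij, of "b D"]
    by (intro add_left_mono mult_left_mono) (auto simp: \<beta>_def r_def power2_commute)
  also have "\<dots> = V + 2 * K * (K - (\<beta> * w - K * \<beta>\<^sup>2))"
    by (simp add: algebra_simps power2_eq_square)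
  also have "\<dots> \<le> V + 2 * K * (3 * K - ?l * min (w\<^sup>2) w)"
  proof -
    have "?l * min (w\<^sup>2) w \<le> \<beta> * w - K * \<beta>\<^sup>2 + 2 * K"
    proof (rule capped_square_le_drift[OF K_pos K l])
      show "?l * min w 1 \<le> \<beta>"
        unfolding w \<beta>_def using l m by (intro slope_inf_mult_min_le b_mono) (auto simp: r_def)
      show "\<beta> \<le> 2" using b_range[of D] b_range[of r] by (auto simp: \<beta>_def)
      have "\<beta> \<le> L * w" using lipschitz_onD[OF b_lipschitz, of D r] by (simp add: \<beta>_def w dist_real_def)
      then have "K * \<beta> \<le> K * L * w" using K_pos by (simp add: mult.assoc)
      also have "\<dots> \<le> 1 * w" using KL by (intro mult_right_mono) (auto simp: w)
      finally show "K * \<beta> \<le> w" by simp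
    qed (simp add: w)
    then show ?thesis using K_pos by (intro add_left_mono mult_left_mono) auto
  qed
  finally have "E + 2 * K * ?l * min (w\<^sup>2) w \<le> V + 6 * K\<^sup>2"
    by (simp add: algebra_simps power2_eq_square)
  moreover have "0 \<le> E" by (simp add: E_def)
  moreover have "0 \<le> 2 * K * ?l * min (w\<^sup>2) w" using K_pos l by (simp add: w)
  moreover have "(\<integral>\<^sup>+ \<omega>. ennreal ((norm (match_update i j x \<omega> - \<rho>))\<^sup>2) \<partial>M) = ennreal E"
    unfolding E_def using int_norm by (rule nn_integral_eq_integral) simp
  ultimately show ?thesis unfolding V_def by (simp add: ennreal_plus[symmetric] del: ennreal_plus)
qed

lemma elo_drift:
  fixes x :: "real ^ 'n"
  assumes m: "m \<ge> 1" "\<And>i j. \<bar>\<rho> $ i - \<rho> $ j\<bar> \<le> m - 1" and K: "K \<le> slope_inf b m / 2"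
  shows "(\<integral>\<^sup>+ y. ennreal ((norm (y - \<rho>))\<^sup>2) \<partial>elo_kernel M S b K x)
      + ennreal (2 * K * slope_inf b m * mean_capped_square \<rho> x)
    \<le> ennreal ((norm (x - \<rho>))\<^sup>2) + ennreal (6 * K\<^sup>2)"
proof -
  let ?P = "distinct_pairs :: ('n \<times> 'n) set" and ?l = "slope_inf b m"
  let ?c = "real (card ?P)"
  let ?\<phi> = "\<lambda>p. min ((gap \<rho> x p)\<^sup>2) (gap \<rho> x p)"
  let ?V = "(norm (x - \<rho>))\<^sup>2"
  have c: "?c > 0" using distinct_pairs_nonempty by (simp add: card_gt_0_iff)
  have l: "0 < ?l" using slope_pos m by auto
  have \<phi>: "0 \<le> ?\<phi> p" for p by (simp add: gap_def)
  have pair: "(\<integral>\<^sup>+ \<omega>. ennreal ((norm (match_update (fst p) (snd p) x \<omega> - \<rho>))\<^sup>2) \<partial>M) + ennreal (2 * K * ?l * ?\<phi> p)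
      \<le> ennreal (?V + 6 * K\<^sup>2)" (is "?I p + _ \<le> _") if p: "p \<in> ?P" for p
    using match_drift[of "fst p" "snd p" m x] p m K by (auto simp: distinct_pairs_def)
  have "(\<integral>\<^sup>+ y. ennreal ((norm (y - \<rho>))\<^sup>2) \<partial>elo_kernel M S b K x) + ennreal (2 * K * ?l * mean_capped_square \<rho> x)
      = (\<Sum>p\<in>?P. ennreal (1 / ?c) * ?I p) + (\<Sum>p\<in>?P. ennreal (1 / ?c) * ennreal (2 * K * ?l * ?\<phi> p))"
  proof (intro arg_cong2[where f = "(+)"])
    show "(\<integral>\<^sup>+ y. ennreal ((norm (y - \<rho>))\<^sup>2) \<partial>elo_kernel M S b K x) = (\<Sum>p\<in>?P. ennreal (1 / ?c) * ?I p)"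
      by (rule nn_integral_elo_kernel) measurable
    have "(\<Sum>p\<in>?P. ennreal (1 / ?c) * ennreal (2 * K * ?l * ?\<phi> p)) = (\<Sum>p\<in>?P. ennreal (1 / ?c * (2 * K * ?l * ?\<phi> p)))"
      using \<phi> K_pos l by (intro sum.cong refl ennreal_mult[symmetric]) auto
    also have "\<dots> = ennreal (\<Sum>p\<in>?P. 1 / ?c * (2 * K * ?l * ?\<phi> p))"
      using \<phi> K_pos l by (intro sum_ennreal) auto
    also have "(\<Sum>p\<in>?P. 1 / ?c * (2 * K * ?l * ?\<phi> p)) = 2 * K * ?l * mean_capped_square \<rho> x"
      by (simp add: mean_capped_square_def sum_distrib_left sum_divide_distrib)
    finally show "ennreal (2 * K * ?l * mean_capped_square \<rho> x) = (\<Sum>p\<in>?P. ennreal (1 / ?c) * ennreal (2 * K * ?l * ?\<phi> p))" ..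
  qed
  also have "\<dots> = (\<Sum>p\<in>?P. ennreal (1 / ?c) * (?I p + ennreal (2 * K * ?l * ?\<phi> p)))"
    by (simp add: sum.distrib distrib_left)
  also have "\<dots> \<le> (\<Sum>p\<in>?P. ennreal (1 / ?c) * ennreal (?V + 6 * K\<^sup>2))"
    using pair by (intro sum_mono mult_left_mono) auto
  also have "\<dots> = ennreal ?c * ennreal (1 / ?c) * ennreal (?V + 6 * K\<^sup>2)"
    by (simp add: ennreal_of_nat_eq_real_of_nat mult.assoc)
  also have "\<dots> = ennreal ?V + ennreal (6 * K\<^sup>2)"
    using c distinct_pairs_nonempty
    by (simp add: ennreal_mult[symmetric] ennreal_plus[symmetric] del: ennreal_plus)
  finally show ?thesis .
qed

section \<open>Stationary moments\<close>

lemma stationary_mean_capped_square: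
  assumes stat: "elo_stationary M S b K \<pi>"
    and m: "m \<ge> 1" "\<And>i j. \<bar>\<rho> $ i - \<rho> $ j\<bar> \<le> m - 1" and K: "K \<le> slope_inf b m / 2"
  shows "integrable \<pi> (mean_capped_square \<rho>)" "(\<integral> x. mean_capped_square \<rho> x \<partial>\<pi>) \<le> 3 * K / slope_inf b m"
proof -
  let ?l = "slope_inf b m"
  interpret \<pi>: prob_space \<pi> using stat by (simp add: elo_stationary_def)
  have sets[measurable_cong]: "sets \<pi> = sets borel" using stat by (simp add: elo_stationary_def)
  \<comment> \<open>Stationarity is given on sets; as a fixed-point equation it extends to integrals.\<close>
  have \<kappa>: "elo_kernel M S b K \<in> \<pi> \<rightarrow>\<^sub>M subprob_algebra \<pi>"
    using elo_kernel_measurable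
    by (simp cong: measurable_cong_sets add: measurable_cong_sets[OF sets] subprob_algebra_cong[OF sets])
  have inv: "\<pi> \<bind> elo_kernel M S b K = \<pi>"
  proof (rule measure_eqI)
    show "sets (\<pi> \<bind> elo_kernel M S b K) = sets \<pi>"
      by (rule sets_bind_measurable[OF \<kappa> \<pi>.not_empty])
    fix A assume "A \<in> sets (\<pi> \<bind> elo_kernel M S b K)"
    then have A: "A \<in> sets \<pi>" by (simp add: sets_bind_measurable[OF \<kappa> \<pi>.not_empty])
    show "emeasure (\<pi> \<bind> elo_kernel M S b K) A = emeasure \<pi> A"
      using stat A by (simp add: emeasure_bind[OF \<pi>.not_empty \<kappa> A] elo_stationary_def)
  qed
  have l: "0 < ?l" using slope_pos m by auto
  have [measurable]: "mean_capped_square \<rho> \<in> borel_measurable borel"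
    unfolding mean_capped_square_def[abs_def] gap_def divide_inverse
    by (intro borel_measurable_continuous_onI continuous_intros)
  have pos: "0 \<le> mean_capped_square \<rho> x" for x
    by (simp add: mean_capped_square_def gap_def sum_nonneg)
  have "(\<integral>\<^sup>+ x. ennreal (2 * K * ?l * mean_capped_square \<rho> x) \<partial>\<pi>) \<le> ennreal (6 * K\<^sup>2)"
    by (rule nn_integral_le_of_drift[OF \<kappa> inv \<pi>.prob_space_axioms, where V = "\<lambda>x. ennreal ((norm (x - \<rho>))\<^sup>2)"])
       (use elo_drift[OF m K] in auto)
  also have "(\<integral>\<^sup>+ x. ennreal (2 * K * ?l * mean_capped_square \<rho> x) \<partial>\<pi>)
      = ennreal (2 * K * ?l) * (\<integral>\<^sup>+ x. ennreal (mean_capped_square \<rho> x) \<partial>\<pi>)"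
    using K_pos l pos by (subst nn_integral_cmult[symmetric]) (auto simp: ennreal_mult)
  finally have le: "ennreal (2 * K * ?l) * (\<integral>\<^sup>+ x. ennreal (mean_capped_square \<rho> x) \<partial>\<pi>) \<le> ennreal (6 * K\<^sup>2)" .
  have fin: "(\<integral>\<^sup>+ x. ennreal (mean_capped_square \<rho> x) \<partial>\<pi>) < \<infinity>"
  proof (rule ccontr)
    assume "\<not> ?thesis"
    then show False using le K_pos l by (simp add: not_less top_unique ennreal_mult_top)
  qed
  show int: "integrable \<pi> (mean_capped_square \<rho>)"
    using fin pos by (intro integrableI_nonneg) auto
  then have "ennreal (2 * K * ?l * (\<integral> x. mean_capped_square \<rho> x \<partial>\<pi>)) \<le> ennreal (6 * K\<^sup>2)"
    using le K_pos l pos by (simp add: nn_integral_eq_integral ennreal_mult)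
  then have "2 * K * ?l * (\<integral> x. mean_capped_square \<rho> x \<partial>\<pi>) \<le> 6 * K\<^sup>2"
    by (subst (asm) ennreal_le_iff) auto
  then have "2 * K * (?l * (\<integral> x. mean_capped_square \<rho> x \<partial>\<pi>)) \<le> 2 * K * (3 * K)"
    by (simp add: power2_eq_square mult.assoc)
  then have "?l * (\<integral> x. mean_capped_square \<rho> x \<partial>\<pi>) \<le> 3 * K"
    using K_pos by (subst (asm) mult_le_cancel_left_pos) auto
  then show "(\<integral> x. mean_capped_square \<rho> x \<partial>\<pi>) \<le> 3 * K / ?l" using l by (simp add: field_simps)
qed

lemma stationary_norm1:
  assumes stat: "elo_stationary M S b K \<pi>"
    and m: "m \<ge> 1" "\<And>i j. \<bar>\<rho> $ i - \<rho> $ j\<bar> \<le> m - 1" and K: "K \<le> slope_inf b m / 2"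
  shows "integrable \<pi> (\<lambda>x. 1 / real CARD('n) * norm1 (x - \<rho>))"
    and "(\<integral> x. 1 / real CARD('n) * norm1 (x - \<rho>) \<partial>\<pi>)
      \<le> (real CARD('n) - 1) / real CARD('n) * sqrt (8 * K / slope_inf b m)"
proof -
  let ?l = "slope_inf b m" and ?n = "real CARD('n)"
  define s where "s = sqrt (8 * K / ?l)"
  have l: "0 < ?l" using slope_pos m by auto
  have s2: "s\<^sup>2 = 8 * K / ?l" using K_pos l by (simp add: s_def)
  have "8 * K / ?l \<le> 2\<^sup>2" using K l by (simp add: field_simps)
  \<comment> \<open>The smallness of \<open>K\<close> keeps \<open>s\<close> in the range where \<open>capped_square_optimum\<close> holds.\<close>
  then have s: "0 < s" "s \<le> 2"
    using K_pos l by (auto simp: s_def intro: real_le_lsqrt)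
  interpret \<pi>: prob_space \<pi> using stat by (simp add: elo_stationary_def)
  have sets[measurable_cong]: "sets \<pi> = sets borel" using stat by (simp add: elo_stationary_def)
  have [measurable]: "(\<lambda>x. norm1 (x - \<rho>)) \<in> borel_measurable borel"
    unfolding norm1_def by (intro borel_measurable_continuous_onI continuous_intros)
  have z: "AE x in \<pi>. x \<in> zero_sum"
    using stat by (intro \<pi>.AE_prob_1) (simp add: elo_stationary_def measure_def)
  define F where "F x = (?n - 1) / ?n * (mean_capped_square \<rho> x / min s 1 + min s 1 / 4)" for x
  note capped = stationary_mean_capped_square[OF stat m K]
  have F: "integrable \<pi> F" unfolding F_def using capped(1) by simp
  have le: "AE x in \<pi>. 1 / ?n * norm1 (x - \<rho>) \<le> F x"
    using z unfolding F_def by eventually_elim (rule norm1_le_mean_capped_square[OF two_players _ skills s(1)])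
  have nn: "0 \<le> norm1 y" for y :: "real ^ 'n" by (simp add: norm1_def sum_nonneg)
  show int: "integrable \<pi> (\<lambda>x. 1 / ?n * norm1 (x - \<rho>))"
  proof (rule Bochner_Integration.integrable_bound[OF F])
    show "AE x in \<pi>. norm (1 / ?n * norm1 (x - \<rho>)) \<le> norm (F x)"
      using le by eventually_elim (simp add: nn)
  qed measurable
  have "(\<integral> x. 1 / ?n * norm1 (x - \<rho>) \<partial>\<pi>) \<le> (\<integral> x. F x \<partial>\<pi>)"
    by (rule integral_mono_AE[OF int F le])
  also have "\<dots> = (?n - 1) / ?n * ((\<integral> x. mean_capped_square \<rho> x \<partial>\<pi>) / min s 1 + min s 1 / 4)"
    unfolding F_def using capped(1) by (simp add: \<pi>.prob_space)
  also have "\<dots> \<le> (?n - 1) / ?n * ((3 / 8 * s\<^sup>2) / min s 1 + min s 1 / 4)"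
    using capped(2) s two_players by (intro mult_left_mono add_right_mono divide_right_mono) (auto simp: s2)
  also have "\<dots> \<le> (?n - 1) / ?n * s"
    using two_players by (intro mult_left_mono capped_square_optimum s) auto
  finally show "(\<integral> x. 1 / ?n * norm1 (x - \<rho>) \<partial>\<pi>) \<le> (?n - 1) / ?n * sqrt (8 * K / ?l)"
    by (simp add: s_def)
qed

end

theorem theorem20:
  fixes M :: "'w measure" and S :: "'n::finite \<Rightarrow> 'n \<Rightarrow> 'w \<Rightarrow> real"
    and \<rho> :: "real ^ 'n" and b :: "real \<Rightarrow> real" and L K \<eta> :: real
    and \<pi> :: "(real ^ 'n) measure"
    and \<Omega> :: "'o measure" and X :: "'o \<Rightarrow> real ^ 'n"
  assumes "elo_model M S \<rho> b L K"
    and "elo_stationary M S b K \<pi>"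
    and "prob_space \<Omega>" and "X \<in> borel_measurable \<Omega>" and "distr \<Omega> borel X = \<pi>"
    and "\<eta> = 1 + 2 * (MAX i. \<bar>\<rho> $ i\<bar>)"
    and "K \<le> slope_inf b \<eta> / 2"
  shows "integrable \<Omega> (\<lambda>\<omega>. 1 / real CARD('n) * norm1 (X \<omega> - \<rho>)) \<and>
    prob_space.expectation \<Omega> (\<lambda>\<omega>. 1 / real CARD('n) * norm1 (X \<omega> - \<rho>))
      \<le> (real CARD('n) - 1) / real CARD('n) * sqrt (8 * K / slope_inf b \<eta>)"
proof -
  interpret elo_model M S \<rho> b L K by fact
  have max: "\<bar>\<rho> $ i\<bar> \<le> (MAX i. \<bar>\<rho> $ i\<bar>)" for i by (rule Max_ge) auto
  have "0 \<le> (MAX i. \<bar>\<rho> $ i\<bar>)" using max[of undefined] by linarith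
  then have \<eta>: "\<eta> \<ge> 1" using assms(6) by linarith
  have spread: "\<bar>\<rho> $ i - \<rho> $ j\<bar> \<le> \<eta> - 1" for i j
    using max[of i] max[of j] assms(6) by linarith
  note bound = stationary_norm1[OF assms(2) \<eta> spread assms(7)]
  have meas: "(\<lambda>x. 1 / real CARD('n) * norm1 (x - \<rho>)) \<in> borel_measurable borel"
    unfolding norm1_def by (intro borel_measurable_continuous_onI continuous_intros)
  show ?thesis
    using bound
    unfolding assms(5)[symmetric] integrable_distr_eq[OF assms(4) meas] integral_distr[OF assms(4) meas]
    by (rule conjI)
qed

end
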